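(* There exists a universal constant $C>0$ such that the following holds. Let $(\eta_i)_{i=1}^N$ be a sequence of random vectors in $\mathbb R^p$ adapted to a filtration $(\mathcal F_i)_{i=1}^N$, with $\eta_{ij}\ge0$ and $\eta_{ij}\in L^1(\mathbb P)$ for all $i\in[N]$ and $j\in[p]$. Then, for any $q\ge1$, $$\Bigl\|\max_{j\in[p]}\sum_{i=1}^N\eta_{ij}\Bigr\|_{L^q(\mathbb P)}\le C\left(\Bigl\|\max_{j\in[p]}\sum_{i=1}^N\mathbb E[\eta_{ij}\mid\mathcal F_{i-1}]\Bigr\|_{L^q(\mathbb P)}+(q+\log p)\Bigl\|\max_{i\in[N]}\max_{j\in[p]}\eta_{ij}\Bigr\|_{L^q(\mathbb P)}\right),$$ where $\mathcal F_0:=\{\emptyset,\Omega\}$.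
   Context: $(\Omega,\mathcal A,\mathbb P)$ is the underlying probability space, $\eta_{ij}$ is the $j$-th coordinate of $\eta_i$, $[N]=\{1,\dots,N\}$, and $p\ge3$ is an integer. A universal constant does not depend on $N,p,q$, the filtration or the sequence. Norms may take the value $+\infty$. *)

theory Defs
  imports "HOL-Probability.Probability"
begin

text \<open>
  The \<open>L\<^sup>q\<close> norm for finite exponents \<open>q > 0\<close>, as an extended nonnegative real. There is no
  power with real exponent on \<^typ>\<open>ennreal\<close>, so the value \<open>\<infinity>\<close> is treated separately.
\<close>

definition Lq_norm :: "'a measure \<Rightarrow> real \<Rightarrow> ('a \<Rightarrow> real) \<Rightarrow> ennreal" where
  "Lq_norm M q f =
    (let I = (\<integral>\<^sup>+ \<omega>. ennreal (\<bar>f \<omega>\<bar> powr q) \<partial>M)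
     in if I = \<infinity> then \<infinity> else ennreal (enn2real I powr (1 / q)))"

text \<open>
  Euclidean space of dimension \<open>p\<close>, with its Borel sigma-algebra. The dimension is a natural number
  rather than a type because it is quantified inside the scope of an existential quantifier; vectors
  are functions on \<open>{1..p}\<close>, extended by \<^term>\<open>undefined\<close>.
\<close>

abbreviation borel_vec :: "nat \<Rightarrow> (nat \<Rightarrow> real) measure" where
  "borel_vec p \<equiv> Pi\<^sub>M {1..p} (\<lambda>_. borel)"

text \<open>
  A filtration \<open>(F\<^sub>i)\<close>, \<open>1 \<le> i \<le> N\<close>, of the sigma-algebra of \<open>M\<close>; only the measurable sets of the
  measures \<open>F i\<close> are relevant, not their values as measures. The entry \<open>F 0\<close> is the convention
  for the initial, trivial sigma-algebra.
\<close>

definition finite_filtration :: "'a measure \<Rightarrow> nat \<Rightarrow> (nat \<Rightarrow> 'a measure) \<Rightarrow> bool" where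
  "finite_filtration M N F \<longleftrightarrow>
    space (F 0) = space M \<and> sets (F 0) = {{}, space M} \<and>
    (\<forall>i\<in>{1..N}. subalgebra M (F i)) \<and>
    (\<forall>i\<in>{1..N}. \<forall>k\<in>{i..N}. sets (F i) \<subseteq> sets (F k))"

end

theory Submission
  imports Defs
begin

text \<open>
  The proof is a good-\<open>\<lambda>\<close> argument. Let \<open>X\<close>, \<open>A\<close> and \<open>K\<close> be the three maxima in the theorem: of
  the sums, of the compensators and of the individual terms. Put \<open>L = q + ln p\<close>. The key estimate,
  valid for every \<open>t > 0\<close>, is
  \<open>P(X > 3t) \<le> exp(-4q) P(X > t) + P(A > t/4) + P(K > t/(8L))\<close>.
  Integrated against \<open>q t powr (q - 1)\<close>, it bounds \<open>E((X/3) powr q)\<close> by \<open>exp(-4q) E(X powr q)\<close> plus the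
  moments of \<open>4A\<close> and \<open>8LK\<close>. Since \<open>3 powr q * exp(-4q) \<le> 1/2\<close> and \<open>E(X powr q)\<close> is finite as soon
  as \<open>E(K powr q)\<close> is (because \<open>X \<le> N K\<close>), the first term is absorbed on the left. This gives
  the constant 48.

  The key estimate rests on an exponential supermartingale: if \<open>0 \<le> \<xi>\<^sub>i \<le> 1\<close> are adapted, then
  \<open>E exp(\<Sum> \<xi>\<^sub>i - 2 \<Sum> E[\<xi>\<^sub>i | F\<^sub>i\<^sub>-\<^sub>1]) \<le> 1\<close> (lemma \<open>exp_compensated_sum_le_one\<close>). Take a
  coordinate \<open>j\<close> with sum \<open>S\<close>, put \<open>b = t/(8L) \<le> t\<close>, and let \<open>\<xi>\<^sub>i\<close> be \<open>\<eta>\<^sub>i\<^sub>j / b\<close>, replaced by zero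
  if \<open>\<eta>\<^sub>i\<^sub>j > b\<close> or if the partial sum of the first \<open>i - 1\<close> terms does not exceed \<open>t\<close>. The
  exponential is then 1 almost everywhere on \<open>{S \<le> t}\<close>, so that its integral over \<open>{S > t}\<close> is at
  most \<open>P(S > t)\<close>. On the event that \<open>S > 3t\<close> while \<open>A \<le> t/4\<close> and \<open>K \<le> b\<close>, at least \<open>t\<close> of the sum
  is collected after the level \<open>t\<close> has been passed, so the exponential is at least
  \<open>exp(t/b - t/(2b)) = exp(4L)\<close>. Hence that event has probability at most
  \<open>exp(-4L) P(S > t) \<le> exp(-4L) P(X > t)\<close> (lemma \<open>good_lambda_scalar\<close>), and a union bound over the
  \<open>p\<close> coordinates (lemma \<open>good_lambda_max\<close>) costs a factor \<open>p\<close>, with \<open>p exp(-4L) \<le> exp(-4q)\<close>.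
  Comparing the exponential with 1 on \<open>{S \<le> t}\<close> replaces conditioning at the first passage time.
\<close>

section \<open>An exponential supermartingale\<close>

text \<open>
  The variables \<open>c i\<close> need only dominate the conditional expectations, which allows them to be chosen
  as convenient versions.
\<close>

lemma exp_compensated_sum_le_one:
  fixes \<xi> c :: "nat \<Rightarrow> 'a \<Rightarrow> real"
  assumes "prob_space M"
    and sub: "\<And>i. i \<le> n \<Longrightarrow> subalgebra M (F i)"
    and mono: "\<And>i k. i \<le> k \<Longrightarrow> k \<le> n \<Longrightarrow> sets (F i) \<subseteq> sets (F k)"
    and \<xi>_meas: "\<And>i. i \<in> {1..n} \<Longrightarrow> \<xi> i \<in> borel_measurable (F i)"
    and \<xi>_bounds: "\<And>i \<omega>. i \<in> {1..n} \<Longrightarrow> 0 \<le> \<xi> i \<omega> \<and> \<xi> i \<omega> \<le> 1"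
    and c_meas: "\<And>i. i \<in> {1..n} \<Longrightarrow> c i \<in> borel_measurable (F (i - 1))"
    and c_ge: "\<And>i. i \<in> {1..n} \<Longrightarrow> AE \<omega> in M. real_cond_exp M (F (i - 1)) (\<xi> i) \<omega> \<le> c i \<omega>"
  defines "Z \<equiv> \<lambda>n \<omega>. exp ((\<Sum>i=1..n. \<xi> i \<omega>) - 2 * (\<Sum>i=1..n. c i \<omega>))"
  shows "integrable M (Z n) \<and> (\<integral>\<omega>. Z n \<omega> \<partial>M) \<le> 1"
proof -
  interpret prob_space M by fact
  have lift: "f \<in> borel_measurable (F k)"
    if "f \<in> borel_measurable (F i)" "i \<le> k" "k \<le> n" for f :: "'a \<Rightarrow> real" and i k
    using that sub[of i] sub[of k] mono[of i k]
    by (intro measurable_from_subalg[of "F k" "F i"]) (auto simp: subalgebra_def)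
  have "m \<le> n \<Longrightarrow> integrable M (Z m) \<and> (\<integral>\<omega>. Z m \<omega> \<partial>M) \<le> 1" for m
  proof (induction m)
    case 0
    then show ?case by (simp add: Z_def prob_space)
  next
    case (Suc m)
    then have IH: "integrable M (Z m)" "(\<integral>\<omega>. Z m \<omega> \<partial>M) \<le> 1" by auto
    have m: "m \<le> n" "Suc m \<in> {1..n}" using Suc.prems by auto
    interpret fm: finite_measure_subalgebra M "F m"
      by unfold_locales (use sub m in auto)
    \<comment> \<open>\<open>Z (Suc m) = G * exp (\<xi> (Suc m))\<close> with \<open>G\<close> measurable with respect to \<open>F m\<close>. Since
      \<open>exp x \<le> 1 + 2 * x\<close> on the unit interval, only \<open>\<xi> (Suc m)\<close> itself has to be conditioned.\<close>
    let ?E = "real_cond_exp M (F m) (\<xi> (Suc m))"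
    define G where "G = (\<lambda>\<omega>. Z m \<omega> * exp (- 2 * c (Suc m) \<omega>))"
    have xm [measurable]: "\<xi> (Suc m) \<in> borel_measurable M"
      using measurable_from_subalg[OF sub[of "Suc m"] \<xi>_meas[OF m(2)]] m by auto
    have cm: "c (Suc m) \<in> borel_measurable (F m)" using c_meas[OF m(2)] by simp
    have [measurable]: "c (Suc m) \<in> borel_measurable M"
      by (rule measurable_from_subalg[OF sub[OF m(1)] cm])
    have si: "\<xi> i \<in> borel_measurable (F m)" "c i \<in> borel_measurable (F m)" if "i \<in> {1..m}" for i
      using that m lift[OF \<xi>_meas[of i], of m] lift[OF c_meas[of i], of m] by auto
    have ZF: "Z m \<in> borel_measurable (F m)" unfolding Z_def using si by measurable
    have [measurable]: "Z m \<in> borel_measurable M"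
      by (rule measurable_from_subalg[OF sub[OF m(1)] ZF])
    have GF: "G \<in> borel_measurable (F m)" unfolding G_def using ZF cm by measurable
    have [measurable]: "G \<in> borel_measurable M"
      by (rule measurable_from_subalg[OF sub[OF m(1)] GF])
    have Gpos: "G \<omega> \<ge> 0" for \<omega> by (simp add: G_def Z_def)
    have xint: "integrable M (\<xi> (Suc m))"
      by (rule integrable_const_bound[of _ 1]) (use \<xi>_bounds[OF m(2)] in auto)
    have Epos: "AE \<omega> in M. ?E \<omega> \<ge> 0"
      by (rule fm.real_cond_exp_pos) (use \<xi>_bounds[OF m(2)] in auto)
    have Ele: "AE \<omega> in M. ?E \<omega> \<le> c (Suc m) \<omega>" using c_ge[OF m(2)] by simp
    have GZ: "AE \<omega> in M. norm (G \<omega>) \<le> norm (Z m \<omega>)"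
      using Epos Ele by eventually_elim (auto simp: G_def Z_def)
    have Gint: "integrable M G"
      by (rule Bochner_Integration.integrable_bound[OF IH(1)]) (use GZ in auto)
    have Gxint: "integrable M (\<lambda>\<omega>. G \<omega> * \<xi> (Suc m) \<omega>)"
      by (rule Bochner_Integration.integrable_bound[OF Gint])
        (use \<xi>_bounds[OF m(2)] in \<open>auto simp: abs_mult mult_left_le\<close>)
    note GE = fm.real_cond_exp_intg[OF Gxint GF xm]
    have Zeq: "Z (Suc m) \<omega> = G \<omega> * exp (\<xi> (Suc m) \<omega>)" for \<omega>
      by (simp add: G_def Z_def exp_add[symmetric] algebra_simps)
    have Zle: "Z (Suc m) \<omega> \<le> G \<omega> + 2 * (G \<omega> * \<xi> (Suc m) \<omega>)" for \<omega>
    proof -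
      let ?x = "\<xi> (Suc m) \<omega>"
      have x: "0 \<le> ?x" "?x \<le> 1" using \<xi>_bounds[OF m(2)] by auto
      have "exp ?x \<le> 1 + ?x + ?x\<^sup>2" by (rule exp_bound) (use x in auto)
      also have "\<dots> \<le> 1 + 2 * ?x" using x by (simp add: power2_eq_square mult_left_le)
      finally show ?thesis
        unfolding Zeq using mult_left_mono[OF _ Gpos[of \<omega>]] by (fastforce simp: algebra_simps)
    qed
    have [measurable]: "Z (Suc m) \<in> borel_measurable M" unfolding Zeq[abs_def] by measurable
    have Zpos: "0 \<le> Z (Suc m) \<omega>" for \<omega> by (simp add: Z_def)
    have int2: "integrable M (\<lambda>\<omega>. G \<omega> + 2 * (G \<omega> * \<xi> (Suc m) \<omega>))"
      using Gint Gxint by auto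
    have Zint: "integrable M (Z (Suc m))"
      by (rule Bochner_Integration.integrable_bound[OF int2])
        (use Zpos Zle order_trans[OF Zpos Zle] in \<open>auto simp del: sum.cl_ivl_Suc\<close>)
    have "(\<integral>\<omega>. Z (Suc m) \<omega> \<partial>M) \<le> (\<integral>\<omega>. G \<omega> + 2 * (G \<omega> * \<xi> (Suc m) \<omega>) \<partial>M)"
      by (rule integral_mono[OF Zint int2]) (rule Zle)
    also have "\<dots> = (\<integral>\<omega>. G \<omega> \<partial>M) + 2 * (\<integral>\<omega>. G \<omega> * ?E \<omega> \<partial>M)"
      using Gint Gxint GE by simp
    also have "\<dots> = (\<integral>\<omega>. G \<omega> + 2 * (G \<omega> * ?E \<omega>) \<partial>M)"
      using Gint GE by simp
    also have "\<dots> \<le> (\<integral>\<omega>. Z m \<omega> \<partial>M)"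
    proof (rule integral_mono_AE)
      show "integrable M (\<lambda>\<omega>. G \<omega> + 2 * (G \<omega> * ?E \<omega>))" using Gint GE by auto
      show "AE \<omega> in M. G \<omega> + 2 * (G \<omega> * ?E \<omega>) \<le> Z m \<omega>"
        using Ele
      proof eventually_elim
        case (elim \<omega>)
        have "1 + 2 * ?E \<omega> \<le> 1 + 2 * c (Suc m) \<omega>" using elim by simp
        also have "\<dots> \<le> exp (2 * c (Suc m) \<omega>)" by (rule exp_ge_add_one_self)
        finally have "G \<omega> * (1 + 2 * ?E \<omega>) \<le> G \<omega> * exp (2 * c (Suc m) \<omega>)"
          by (rule mult_left_mono[OF _ Gpos])
        also have "\<dots> = Z m \<omega>" by (simp add: G_def mult.assoc exp_add[symmetric])
        finally show ?case by (simp add: algebra_simps)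
      qed
    qed (rule IH)
    finally show ?case using Zint IH(2) by auto
  qed
  then show ?thesis by auto
qed

section \<open>The good-\<open>\<lambda>\<close> inequality\<close>

text \<open>
  The estimate for a single coordinate, with the exponential factor kept on the left.
\<close>

lemma good_lambda_scalar:
  fixes \<eta> :: "nat \<Rightarrow> 'a \<Rightarrow> real"
  assumes "prob_space M"
    and sub: "\<And>i. i \<le> N \<Longrightarrow> subalgebra M (F i)"
    and mono: "\<And>i k. i \<le> k \<Longrightarrow> k \<le> N \<Longrightarrow> sets (F i) \<subseteq> sets (F k)"
    and meas: "\<And>i. i \<in> {1..N} \<Longrightarrow> \<eta> i \<in> borel_measurable (F i)"
    and nonneg: "\<And>i. i \<in> {1..N} \<Longrightarrow> AE \<omega> in M. 0 \<le> \<eta> i \<omega>"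
    and int: "\<And>i. i \<in> {1..N} \<Longrightarrow> integrable M (\<eta> i)"
    and b: "0 < b" "b \<le> t"
  defines "a \<equiv> \<lambda>i. real_cond_exp M (F (i - 1)) (\<eta> i)"
  shows "exp (t / (2 * b)) * measure M {\<omega> \<in> space M. (\<Sum>i=1..N. \<eta> i \<omega>) > 3 * t
        \<and> (\<Sum>i=1..N. a i \<omega>) \<le> t / 4 \<and> (\<forall>i\<in>{1..N}. \<eta> i \<omega> \<le> b)}
    \<le> measure M {\<omega> \<in> space M. (\<Sum>i=1..N. \<eta> i \<omega>) > t}"
proof -
  interpret prob_space M by fact
  \<comment> \<open>\<open>w i\<close> is the predictable indicator that the level \<open>t\<close> has been passed before time \<open>i\<close>.\<close>
  define w where "w = (\<lambda>i \<omega>. of_bool ((\<Sum>l=1..i - 1. \<eta> l \<omega>) > t) :: real)"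
  \<comment> \<open>Since \<open>\<eta>\<close> is nonnegative only almost everywhere, negative values are cut off as well; the
    bounds on \<open>\<xi>\<close> then hold everywhere.\<close>
  define \<xi> where "\<xi> = (\<lambda>i \<omega>. w i \<omega> * (if 0 \<le> \<eta> i \<omega> \<and> \<eta> i \<omega> \<le> b then \<eta> i \<omega> / b else 0))"
  define c where "c = (\<lambda>i \<omega>. w i \<omega> * (a i \<omega> / b))"
  define Z where "Z = (\<lambda>\<omega>. exp ((\<Sum>i=1..N. \<xi> i \<omega>) - 2 * (\<Sum>i=1..N. c i \<omega>)))"
  define E where "E = {\<omega> \<in> space M. (\<Sum>i=1..N. \<eta> i \<omega>) > 3 * t
        \<and> (\<Sum>i=1..N. a i \<omega>) \<le> t / 4 \<and> (\<forall>i\<in>{1..N}. \<eta> i \<omega> \<le> b)}"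
  define D where "D = {\<omega> \<in> space M. (\<Sum>i=1..N. \<eta> i \<omega>) > t}"
  have lift: "f \<in> borel_measurable (F k)"
    if "f \<in> borel_measurable (F i)" "i \<le> k" "k \<le> N" for f :: "'a \<Rightarrow> real" and i k
    using that sub[of i] sub[of k] mono[of i k]
    by (intro measurable_from_subalg[of "F k" "F i"]) (auto simp: subalgebra_def)
  have \<eta>M [measurable]: "\<eta> i \<in> borel_measurable M" if "i \<in> {1..N}" for i
    using measurable_from_subalg[OF sub[of i] meas[OF that]] that by auto
  have w_meas: "w i \<in> borel_measurable (F k)" if "i \<in> {1..N}" "i - 1 \<le> k" "k \<le> N" for i k
  proof -
    have [measurable]: "\<eta> l \<in> borel_measurable (F k)" if "l \<in> {1..i - 1}" for l
      using that \<open>i \<in> {1..N}\<close> \<open>i - 1 \<le> k\<close> \<open>k \<le> N\<close> by (intro lift[OF meas[of l]]) auto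
    have "{\<omega> \<in> space (F k). (\<Sum>l=1..i - 1. \<eta> l \<omega>) > t} \<in> sets (F k)"
      by (intro borel_measurable_less) auto
    then show ?thesis
      unfolding w_def of_bool_def by (intro measurable_If) auto
  qed
  have a_meas: "a i \<in> borel_measurable (F (i - 1))" for i unfolding a_def by simp
  have aM [measurable]: "a i \<in> borel_measurable M" for i unfolding a_def by simp
  have fm: "finite_measure_subalgebra M (F (i - 1))" if "i \<in> {1..N}" for i
    by unfold_locales (use that sub[of "i - 1"] in auto)
  have c_ge: "AE \<omega> in M. real_cond_exp M (F (i - 1)) (\<xi> i) \<omega> \<le> c i \<omega>" if i: "i \<in> {1..N}" for i
  proof -
    interpret finite_measure_subalgebra M "F (i - 1)" by (rule fm[OF i])
    have wF: "w i \<in> borel_measurable (F (i - 1))" by (rule w_meas[OF i]) (use i in auto)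
    have wM [measurable]: "w i \<in> borel_measurable M"
      using measurable_from_subalg[OF sub[of "i - 1"] wF] i by auto
    note [measurable] = \<eta>M[OF i]
    have intw: "integrable M (\<lambda>\<omega>. w i \<omega> * (\<eta> i \<omega> / b))"
    proof (rule Bochner_Integration.integrable_bound[of _ "\<lambda>\<omega>. \<eta> i \<omega> / b"])
      show "AE \<omega> in M. norm (w i \<omega> * (\<eta> i \<omega> / b)) \<le> norm (\<eta> i \<omega> / b)"
        by (simp add: w_def)
    qed (use int[OF i] in simp, measurable)
    have "AE \<omega> in M. real_cond_exp M (F (i - 1)) (\<xi> i) \<omega>
        \<le> real_cond_exp M (F (i - 1)) (\<lambda>\<omega>. w i \<omega> * (\<eta> i \<omega> / b)) \<omega>"
    proof (rule real_cond_exp_mono)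
      show "AE \<omega> in M. \<xi> i \<omega> \<le> w i \<omega> * (\<eta> i \<omega> / b)"
        using nonneg[OF i] by eventually_elim (use b in \<open>auto simp: \<xi>_def w_def\<close>)
      have "\<xi> i \<in> borel_measurable M" unfolding \<xi>_def by measurable
      then show "integrable M (\<xi> i)"
        by (rule Bochner_Integration.integrable_bound[OF intw]) (use b in \<open>auto simp: \<xi>_def\<close>)
    qed (rule intw)
    moreover have "AE \<omega> in M. real_cond_exp M (F (i - 1)) (\<lambda>\<omega>. w i \<omega> * (\<eta> i \<omega> / b)) \<omega>
        = w i \<omega> * real_cond_exp M (F (i - 1)) (\<lambda>\<omega>. \<eta> i \<omega> / b) \<omega>"
      by (rule real_cond_exp_mult[OF wF _ intw]) measurable
    moreover have "AE \<omega> in M. real_cond_exp M (F (i - 1)) (\<lambda>\<omega>. \<eta> i \<omega> / b) \<omega> = a i \<omega> / b"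
      unfolding a_def by (rule real_cond_exp_cdiv[OF int[OF i]])
    ultimately show ?thesis by eventually_elim (simp add: c_def)
  qed
  have Z: "integrable M Z \<and> (\<integral>\<omega>. Z \<omega> \<partial>M) \<le> 1"
    unfolding Z_def
  proof (rule exp_compensated_sum_le_one[OF assms(1) sub mono])
    fix i assume i: "i \<in> {1..N}"
    show "\<xi> i \<in> borel_measurable (F i)"
    proof -
      have [measurable]: "w i \<in> borel_measurable (F i)" by (rule w_meas[OF i]) (use i in auto)
      note [measurable] = meas[OF i]
      show ?thesis unfolding \<xi>_def by measurable
    qed
    show "c i \<in> borel_measurable (F (i - 1))"
    proof -
      have [measurable]: "w i \<in> borel_measurable (F (i - 1))" by (rule w_meas[OF i]) (use i in auto)
      note [measurable] = a_meas[of i]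
      show ?thesis unfolding c_def by measurable
    qed
    show "0 \<le> \<xi> i \<omega> \<and> \<xi> i \<omega> \<le> 1" for \<omega> using b by (auto simp: \<xi>_def w_def)
  qed (use c_ge in auto)
  have D_meas [measurable]: "D \<in> sets M"
    unfolding D_def by (intro borel_measurable_less) auto
  have E_meas [measurable]: "E \<in> sets M"
    unfolding E_def by measurable
  have "AE \<omega> in M. \<forall>i\<in>{1..N}. 0 \<le> \<eta> i \<omega>"
    using nonneg by (intro AE_finite_allI) auto
  moreover have "AE \<omega> in M. \<forall>i\<in>{1..N}. 0 \<le> a i \<omega>"
  proof (intro AE_finite_allI)
    fix i assume i: "i \<in> {1..N}"
    interpret finite_measure_subalgebra M "F (i - 1)" by (rule fm[OF i])
    show "AE \<omega> in M. 0 \<le> a i \<omega>"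
      unfolding a_def by (rule real_cond_exp_pos) (use nonneg[OF i] \<eta>M[OF i] in auto)
  qed auto
  ultimately have lower: "AE \<omega> in M. exp (t / (2 * b)) * indicator E \<omega> + indicator (space M - D) \<omega> \<le> Z \<omega>"
  proof eventually_elim
    case (elim \<omega>)
    show ?case
    proof (cases "\<omega> \<in> E")
      case True
      then have X: "(\<Sum>i=1..N. \<eta> i \<omega>) > 3 * t" and A: "(\<Sum>i=1..N. a i \<omega>) \<le> t / 4"
        and small: "\<And>i. i \<in> {1..N} \<Longrightarrow> \<eta> i \<omega> \<le> b" and "\<omega> \<in> space M" by (auto simp: E_def)
      have "\<omega> \<in> D" using X \<open>\<omega> \<in> space M\<close> b by (auto simp: D_def)
      \<comment> \<open>What is collected up to and including the passage is at most \<open>t\<close> plus one jump. The induction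
        is on the time: either the level has not yet been passed, or the new term vanishes.\<close>
      have before: "(\<Sum>i=1..n. (1 - w i \<omega>) * \<eta> i \<omega>) \<le> t + b" if "n \<le> N" for n
        using that
      proof (induction n)
        case (Suc n)
        show ?case
        proof (cases "w (Suc n) \<omega> = 0")
          case True
          have "(\<Sum>i=1..n. (1 - w i \<omega>) * \<eta> i \<omega>) \<le> (\<Sum>i=1..n. \<eta> i \<omega>)"
            by (rule sum_mono) (use elim Suc.prems in \<open>auto simp: w_def\<close>)
          also have "\<dots> \<le> t" using True by (auto simp: w_def not_less)
          finally show ?thesis using small[of "Suc n"] Suc.prems True by simp
        next
          case False
          then have "w (Suc n) \<omega> = 1" by (simp add: w_def)
          then show ?thesis using Suc by simp
        qed
      qed (use b in simp)
      have "t \<le> (\<Sum>i=1..N. \<eta> i \<omega>) - (\<Sum>i=1..N. (1 - w i \<omega>) * \<eta> i \<omega>)"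
        using X before[of N] b by simp
      also have "\<dots> = (\<Sum>i=1..N. w i \<omega> * \<eta> i \<omega>)"
        by (simp add: sum_subtractf[symmetric] algebra_simps)
      also have "\<dots> = (\<Sum>i=1..N. b * \<xi> i \<omega>)"
        by (rule sum.cong) (use small elim b in \<open>auto simp: \<xi>_def\<close>)
      finally have xi: "t / b \<le> (\<Sum>i=1..N. \<xi> i \<omega>)"
        using b by (simp add: sum_distrib_left[symmetric] field_simps)
      have "(\<Sum>i=1..N. c i \<omega>) \<le> (\<Sum>i=1..N. a i \<omega> / b)"
        by (rule sum_mono) (use elim b in \<open>auto simp: c_def w_def\<close>)
      also have "\<dots> \<le> (t / 4) / b"
        unfolding sum_divide_distrib[symmetric] by (rule divide_right_mono) (use A b in auto)
      finally have "t / (2 * b) \<le> (\<Sum>i=1..N. \<xi> i \<omega>) - 2 * (\<Sum>i=1..N. c i \<omega>)"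
        using xi by simp
      then show ?thesis using True \<open>\<omega> \<in> D\<close> by (simp add: Z_def)
    next
      case notE: False
      show ?thesis
      proof (cases "\<omega> \<in> space M - D")
        case True
        \<comment> \<open>Partial sums are nondecreasing, so the level is never passed outside \<open>D\<close>.\<close>
        have "w i \<omega> = 0" if "i \<in> {1..N}" for i
        proof -
          have "(\<Sum>l=1..i - 1. \<eta> l \<omega>) \<le> (\<Sum>l=1..N. \<eta> l \<omega>)"
            by (rule sum_mono2) (use elim \<open>i \<in> {1..N}\<close> in auto)
          also have "\<dots> \<le> t" using True by (auto simp: D_def not_less)
          finally show ?thesis by (simp add: w_def)
        qed
        then have "Z \<omega> = 1" by (simp add: Z_def \<xi>_def c_def)
        then show ?thesis using notE True by simp
      qed (use notE in \<open>simp add: Z_def\<close>)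
    qed
  qed
  \<comment> \<open>The contribution \<open>1 - P(D)\<close> of the complement of \<open>D\<close> is what turns the bound 1 into \<open>P(D)\<close>.\<close>
  have "exp (t / (2 * b)) * measure M E + (1 - measure M D)
      = (\<integral>\<omega>. exp (t / (2 * b)) * indicator E \<omega> + indicator (space M - D) \<omega> \<partial>M)"
    using prob_compl[of D] by (simp add: emeasure_eq_measure)
  also have "\<dots> \<le> (\<integral>\<omega>. Z \<omega> \<partial>M)"
    by (rule integral_mono_AE) (use Z lower in \<open>auto simp: emeasure_eq_measure\<close>)
  also have "\<dots> \<le> 1" using Z by simp
  finally show ?thesis by (simp add: E_def D_def)
qed

lemma good_lambda_max:
  fixes \<eta> :: "nat \<Rightarrow> 'a \<Rightarrow> nat \<Rightarrow> real"
  assumes "prob_space M"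
    and sub: "\<And>i. i \<le> N \<Longrightarrow> subalgebra M (F i)"
    and mono: "\<And>i k. i \<le> k \<Longrightarrow> k \<le> N \<Longrightarrow> sets (F i) \<subseteq> sets (F k)"
    and meas: "\<And>i j. i \<in> {1..N} \<Longrightarrow> j \<in> J \<Longrightarrow> (\<lambda>\<omega>. \<eta> i \<omega> j) \<in> borel_measurable (F i)"
    and nonneg: "\<And>i j. i \<in> {1..N} \<Longrightarrow> j \<in> J \<Longrightarrow> AE \<omega> in M. 0 \<le> \<eta> i \<omega> j"
    and int: "\<And>i j. i \<in> {1..N} \<Longrightarrow> j \<in> J \<Longrightarrow> integrable M (\<lambda>\<omega>. \<eta> i \<omega> j)"
    and J: "finite J" and b: "0 < b" "b \<le> t"
  defines "a \<equiv> \<lambda>i j. real_cond_exp M (F (i - 1)) (\<lambda>\<omega>. \<eta> i \<omega> j)"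
  shows "measure M {\<omega> \<in> space M. \<exists>j\<in>J. (\<Sum>i=1..N. \<eta> i \<omega> j) > 3 * t}
    \<le> card J * exp (- (t / (2 * b))) * measure M {\<omega> \<in> space M. \<exists>j\<in>J. (\<Sum>i=1..N. \<eta> i \<omega> j) > t}
      + (measure M {\<omega> \<in> space M. \<exists>j\<in>J. (\<Sum>i=1..N. a i j \<omega>) > t / 4}
      + measure M {\<omega> \<in> space M. \<exists>i\<in>{1..N}. \<exists>j\<in>J. \<eta> i \<omega> j > b})"
    (is "measure M ?L \<le> _ * measure M ?D + (measure M ?A + measure M ?B)")
proof -
  interpret prob_space M by fact
  define E where "E = (\<lambda>j. {\<omega> \<in> space M. (\<Sum>i=1..N. \<eta> i \<omega> j) > 3 * t
        \<and> (\<Sum>i=1..N. a i j \<omega>) \<le> t / 4 \<and> (\<forall>i\<in>{1..N}. \<eta> i \<omega> j \<le> b)})"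
  have \<eta>M [measurable]: "(\<lambda>\<omega>. \<eta> i \<omega> k) \<in> borel_measurable M" if "i \<in> {1..N}" "k \<in> J" for i k
    using measurable_from_subalg[OF sub[of i] meas[OF that]] that by auto
  have aM [measurable]: "a i j \<in> borel_measurable M" for i j unfolding a_def by simp
  have E [measurable]: "E j \<in> sets M" if "j \<in> J" for j
    unfolding E_def using that by measurable
  have A: "?A \<in> sets M"
    using J by (intro sets.sets_Collect_finite_Ex borel_measurable_less) auto
  have D: "?D \<in> sets M"
    using J by (intro sets.sets_Collect_finite_Ex borel_measurable_less) auto
  have B: "?B \<in> sets M"
    using J by (intro sets.sets_Collect_finite_Ex borel_measurable_less) auto
  have Ej: "measure M (E j) \<le> exp (- (t / (2 * b))) * measure M ?D" if "j \<in> J" for j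
  proof -
    have "exp (t / (2 * b)) * measure M (E j) \<le> measure M {\<omega> \<in> space M. (\<Sum>i=1..N. \<eta> i \<omega> j) > t}"
      unfolding E_def a_def
      by (rule good_lambda_scalar[where \<eta> = "\<lambda>i \<omega>. \<eta> i \<omega> j" and F = F,
            OF assms(1) sub mono meas[OF _ that] nonneg[OF _ that] int[OF _ that] b])
    also have "\<dots> \<le> measure M ?D" using that D by (intro finite_measure_mono) auto
    finally show ?thesis by (simp add: exp_minus field_simps)
  qed
  have "measure M ?L \<le> measure M ((\<Union>j\<in>J. E j) \<union> (?A \<union> ?B))"
  proof (rule finite_measure_mono)
    show "?L \<subseteq> (\<Union>j\<in>J. E j) \<union> (?A \<union> ?B)"
      unfolding E_def by (auto simp flip: not_le)
  qed (use J A B in auto)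
  also have "\<dots> \<le> measure M (\<Union>j\<in>J. E j) + measure M (?A \<union> ?B)"
    using J A B by (intro measure_Un_le) auto
  also have "\<dots> \<le> (\<Sum>j\<in>J. measure M (E j)) + (measure M ?A + measure M ?B)"
    using J A B by (intro add_mono finite_measure_subadditive_finite measure_Un_le) auto
  also have "(\<Sum>j\<in>J. measure M (E j)) \<le> (\<Sum>j\<in>J. exp (- (t / (2 * b))) * measure M ?D)"
    by (rule sum_mono) (rule Ej)
  finally show ?thesis by (simp add: mult.assoc)
qed

section \<open>From tails to moments\<close>

text \<open>The layer-cake formula for the moment of order \<open>q\<close>.\<close>

lemma nn_integral_powr_eq_tail:
  fixes f :: "'a \<Rightarrow> real"
  assumes "sigma_finite_measure M" and [measurable]: "f \<in> borel_measurable M" and q: "q > 0"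
  shows "(\<integral>\<^sup>+\<omega>. ennreal (\<bar>f \<omega>\<bar> powr q) \<partial>M) =
    (\<integral>\<^sup>+t. ennreal (indicator {0<..} t * q * t powr (q - 1)) * emeasure M {\<omega> \<in> space M. \<bar>f \<omega>\<bar> > t} \<partial>lborel)"
proof -
  interpret sigma_finite_measure M by fact
  interpret pair_sigma_finite M lborel ..
  have pt: "ennreal (a powr q) =
      (\<integral>\<^sup>+t. ennreal (indicator {0<..} t * q * t powr (q - 1)) * indicator {t. a > t} t \<partial>lborel)"
    if "a \<ge> 0" for a
  proof -
    have "((\<lambda>t. q * t powr (q - 1)) has_integral q * (a powr q / q)) {0..a}"
      using has_integral_mult_right[OF has_integral_powr_from_0[of "q - 1" a], of q] q that by simp
    from nn_integral_has_integral_lebesgue[OF _ this] q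
    have "ennreal (a powr q) = (\<integral>\<^sup>+t. ennreal (indicator {0..a} t * (q * t powr (q - 1))) \<partial>lborel)"
      by (simp add: field_simps)
    also have "\<dots> = (\<integral>\<^sup>+t. ennreal (indicator {0<..} t * q * t powr (q - 1)) * indicator {t. a > t} t \<partial>lborel)"
    proof (rule nn_integral_cong_AE)
      have "AE t in lborel. t \<noteq> 0" "AE t in lborel. t \<noteq> a" by (rule AE_lborel_singleton)+
      then show "AE t in lborel. ennreal (indicator {0..a} t * (q * t powr (q - 1))) =
          ennreal (indicator {0<..} t * q * t powr (q - 1)) * indicator {t. a > t} t"
        by eventually_elim (auto simp: indicator_def)
    qed
    finally show ?thesis .
  qed
  have "(\<integral>\<^sup>+\<omega>. ennreal (\<bar>f \<omega>\<bar> powr q) \<partial>M) =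
    (\<integral>\<^sup>+\<omega>. \<integral>\<^sup>+t. ennreal (indicator {0<..} t * q * t powr (q - 1)) * indicator {t. \<bar>f \<omega>\<bar> > t} t \<partial>lborel \<partial>M)"
    by (subst pt) auto
  also have "\<dots> = (\<integral>\<^sup>+t. \<integral>\<^sup>+\<omega>. ennreal (indicator {0<..} t * q * t powr (q - 1)) * indicator {t. \<bar>f \<omega>\<bar> > t} t \<partial>M \<partial>lborel)"
    unfolding indicator_def mem_Collect_eq by (rule Fubini'[symmetric]) measurable
  also have "\<dots> = (\<integral>\<^sup>+t. ennreal (indicator {0<..} t * q * t powr (q - 1)) * emeasure M {\<omega> \<in> space M. \<bar>f \<omega>\<bar> > t} \<partial>lborel)"
  proof (rule nn_integral_cong)
    fix t :: real
    have "(\<integral>\<^sup>+\<omega>. ennreal (indicator {0<..} t * q * t powr (q - 1)) * indicator {t. \<bar>f \<omega>\<bar> > t} t \<partial>M)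
      = (\<integral>\<^sup>+\<omega>. ennreal (indicator {0<..} t * q * t powr (q - 1)) * indicator {\<omega> \<in> space M. \<bar>f \<omega>\<bar> > t} \<omega> \<partial>M)"
      by (rule nn_integral_cong) (auto simp: indicator_def)
    also have "\<dots> = ennreal (indicator {0<..} t * q * t powr (q - 1)) * emeasure M {\<omega> \<in> space M. \<bar>f \<omega>\<bar> > t}"
      by (rule nn_integral_cmult_indicator) measurable
    finally show "(\<integral>\<^sup>+\<omega>. ennreal (indicator {0<..} t * q * t powr (q - 1)) * indicator {t. \<bar>f \<omega>\<bar> > t} t \<partial>M)
      = ennreal (indicator {0<..} t * q * t powr (q - 1)) * emeasure M {\<omega> \<in> space M. \<bar>f \<omega>\<bar> > t}" .
  qed
  finally show ?thesis .
qed

lemma nn_integral_powr_le_of_tail_le: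
  fixes f g h k :: "'a \<Rightarrow> real"
  assumes "sigma_finite_measure M"
    and meas [measurable]: "f \<in> borel_measurable M" "g \<in> borel_measurable M"
      "h \<in> borel_measurable M" "k \<in> borel_measurable M"
    and q: "q > 0"
    and tail: "\<And>t. t > 0 \<Longrightarrow> emeasure M {\<omega> \<in> space M. \<bar>f \<omega>\<bar> > t}
      \<le> \<epsilon> * emeasure M {\<omega> \<in> space M. \<bar>g \<omega>\<bar> > t}
        + (emeasure M {\<omega> \<in> space M. \<bar>h \<omega>\<bar> > t} + emeasure M {\<omega> \<in> space M. \<bar>k \<omega>\<bar> > t})"
  shows "(\<integral>\<^sup>+\<omega>. ennreal (\<bar>f \<omega>\<bar> powr q) \<partial>M)
    \<le> \<epsilon> * (\<integral>\<^sup>+\<omega>. ennreal (\<bar>g \<omega>\<bar> powr q) \<partial>M)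
      + ((\<integral>\<^sup>+\<omega>. ennreal (\<bar>h \<omega>\<bar> powr q) \<partial>M) + (\<integral>\<^sup>+\<omega>. ennreal (\<bar>k \<omega>\<bar> powr q) \<partial>M))"
proof -
  interpret sigma_finite_measure M by fact
  define w where "w = (\<lambda>t. ennreal (indicator {0<..} t * q * t powr (q - 1)))"
  define T where "T = (\<lambda>(u::'a \<Rightarrow> real) t. emeasure M {\<omega> \<in> space M. \<bar>u \<omega>\<bar> > t})"
  have w [measurable]: "w \<in> borel_measurable lborel" unfolding w_def by measurable
  have T [measurable]: "T u \<in> borel_measurable lborel" if [measurable]: "u \<in> borel_measurable M" for u
    unfolding T_def by measurable
  have eq: "(\<integral>\<^sup>+\<omega>. ennreal (\<bar>u \<omega>\<bar> powr q) \<partial>M) = (\<integral>\<^sup>+t. w t * T u t \<partial>lborel)"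
    if "u \<in> borel_measurable M" for u
    using nn_integral_powr_eq_tail[OF assms(1) that q] unfolding w_def T_def .
  have "(\<integral>\<^sup>+t. w t * T f t \<partial>lborel) \<le> (\<integral>\<^sup>+t. \<epsilon> * (w t * T g t) + (w t * T h t + w t * T k t) \<partial>lborel)"
  proof (rule nn_integral_mono)
    fix t :: real
    show "w t * T f t \<le> \<epsilon> * (w t * T g t) + (w t * T h t + w t * T k t)"
    proof (cases "t > 0")
      case True
      from mult_left_mono[OF tail[OF this], of "w t"] show ?thesis
        by (simp add: T_def distrib_left mult_ac)
    qed (simp add: w_def)
  qed
  also have "\<dots> = \<epsilon> * (\<integral>\<^sup>+t. w t * T g t \<partial>lborel) + ((\<integral>\<^sup>+t. w t * T h t \<partial>lborel) + (\<integral>\<^sup>+t. w t * T k t \<partial>lborel))"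
    by (simp add: nn_integral_add nn_integral_cmult)
  finally show ?thesis by (simp add: eq)
qed

lemma powr_add_le_add_powr:
  fixes u v q :: real
  assumes "u \<ge> 0" "v \<ge> 0" "q \<ge> 1"
  shows "u powr q + v powr q \<le> (u + v) powr q"
proof (cases "u + v = 0")
  case False
  have split: "s powr q = s * s powr (q - 1)" if "s \<ge> 0" for s :: real
    using that by (cases "s = 0") (auto simp: powr_diff)
  have "u powr q + v powr q \<le> u * (u + v) powr (q - 1) + v * (u + v) powr (q - 1)"
    using assms by (auto simp: split intro!: add_mono mult_left_mono powr_mono2)
  also have "\<dots> = (u + v) powr q" using assms by (simp add: split[of "u + v"] algebra_simps)
  finally show ?thesis .
qed (use assms in \<open>simp add: add_nonneg_eq_0_iff\<close>)

text \<open>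
  In the application, \<open>x\<close>, \<open>a\<close> and \<open>m\<close> are the moments of order \<open>q\<close> of the three maxima. That \<open>x\<close> is
  a real number, hence finite, is what permits the absorption.
\<close>

lemma absorb_good_lambda:
  fixes q L x a m :: real
  assumes q: "q \<ge> 1" and L: "L > 0" and nonneg: "x \<ge> 0" "a \<ge> 0" "m \<ge> 0"
    and le: "(1/3) powr q * x \<le> exp (-4 * q) * x + (4 powr q * a + (8 * L) powr q * m)"
  shows "x powr (1 / q) \<le> 48 * (a powr (1 / q) + L * m powr (1 / q))"
proof -
  define A where "A = a powr (1 / q)"
  define K where "K = m powr (1 / q)"
  have AK: "A \<ge> 0" "K \<ge> 0" "a = A powr q" "m = K powr q"
    using q nonneg by (auto simp: A_def K_def powr_powr)
  have "(3::real) \<le> exp 2" using exp_ge_add_one_self[of 2] by simp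
  then have "3 powr q \<le> exp 2 powr q" using q by (intro powr_mono2) auto
  also have "\<dots> = exp (2 * q)" by (simp add: powr_def mult.commute)
  finally have "3 powr q * exp (-4 * q) \<le> exp (2 * q) * exp (-4 * q)" by simp
  also have "\<dots> = exp (- (2 * q))" by (simp add: exp_add[symmetric])
  also have "\<dots> \<le> exp (-1)" using q by simp
  also have "\<dots> \<le> 1 / 2"
    using exp_ge_add_one_self[of 1] by (simp add: exp_minus field_simps)
  finally have half: "3 powr q * exp (-4 * q) \<le> 1 / 2" .
  have three: "3 powr q * (1/3) powr q = (1::real)" by (simp add: powr_mult[symmetric])
  have "x = 3 powr q * ((1/3) powr q * x)" using three by simp
  also have "\<dots> \<le> 3 powr q * (exp (-4 * q) * x + (4 powr q * a + (8 * L) powr q * m))"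
    using le by (intro mult_left_mono) auto
  also have "\<dots> = (3 powr q * exp (-4 * q)) * x
      + (3 powr q * 4 powr q * a + 3 powr q * (8 * L) powr q * m)" by (simp add: algebra_simps)
  also have "3 powr q * 4 powr q * a = (12 * A) powr q"
    using AK by (simp add: powr_mult[symmetric])
  also have "3 powr q * (8 * L) powr q * m = (24 * L * K) powr q"
    using AK L by (simp add: powr_mult[symmetric])
  also have "(3 powr q * exp (-4 * q)) * x \<le> 1 / 2 * x" using half nonneg by (intro mult_right_mono)
  finally have "x \<le> 2 * ((12 * A) powr q + (24 * L * K) powr q)" by simp
  also have "\<dots> \<le> 2 * (12 * A + 24 * L * K) powr q"
    using AK L q by (intro mult_left_mono powr_add_le_add_powr) auto
  also have "\<dots> \<le> 2 powr q * (12 * A + 24 * L * K) powr q"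
    using q powr_mono[of 1 q 2] by (intro mult_right_mono) auto
  also have "\<dots> = (24 * A + 48 * L * K) powr q"
    using AK L by (simp add: powr_mult[symmetric] algebra_simps)
  finally have "x powr (1 / q) \<le> ((24 * A + 48 * L * K) powr q) powr (1 / q)"
    using q nonneg by (intro powr_mono2) auto
  also have "\<dots> = 24 * A + 48 * L * K" using AK L q by (simp add: powr_powr)
  also have "\<dots> \<le> 48 * (A + L * K)" using AK by simp
  finally show ?thesis by (simp add: A_def K_def)
qed

lemma nn_integral_abs_powr_cmult:
  assumes [measurable]: "f \<in> borel_measurable M" and "c \<ge> 0"
  shows "(\<integral>\<^sup>+\<omega>. ennreal (\<bar>c * f \<omega>\<bar> powr q) \<partial>M) = ennreal (c powr q) * (\<integral>\<^sup>+\<omega>. ennreal (\<bar>f \<omega>\<bar> powr q) \<partial>M)"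
  using assms(2) by (simp add: abs_mult powr_mult ennreal_mult nn_integral_cmult)

lemma Lq_norm_cases:
  obtains "(\<integral>\<^sup>+\<omega>. ennreal (\<bar>f \<omega>\<bar> powr q) \<partial>M) = \<infinity>" "Lq_norm M q f = \<infinity>"
  | I where "I \<ge> 0" "(\<integral>\<^sup>+\<omega>. ennreal (\<bar>f \<omega>\<bar> powr q) \<partial>M) = ennreal I" "Lq_norm M q f = ennreal (I powr (1 / q))"
  by (cases "\<integral>\<^sup>+\<omega>. ennreal (\<bar>f \<omega>\<bar> powr q) \<partial>M" rule: ennreal_cases)
    (auto simp: Lq_norm_def Let_def)

section \<open>The maximal inequality\<close>

lemma finite_filtration_subalgebra:
  assumes "finite_filtration M N F" "i \<le> N"
  shows "subalgebra M (F i)"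
  using assms by (cases "i = 0") (auto simp: finite_filtration_def subalgebra_def)

text \<open>The case \<open>i = 0\<close> uses that \<open>F 0\<close> is trivial.\<close>

lemma finite_filtration_mono:
  assumes "finite_filtration M N F" "i \<le> k" "k \<le> N"
  shows "sets (F i) \<subseteq> sets (F k)"
proof (cases "i = 0")
  case True
  have "space (F k) = space M"
    using finite_filtration_subalgebra[OF assms(1,3)] by (simp add: subalgebra_def)
  then have "space M \<in> sets (F k)" using sets.top[of "F k"] by simp
  then show ?thesis using True assms(1) by (auto simp: finite_filtration_def)
qed (use assms in \<open>auto simp: finite_filtration_def\<close>)

theorem lemma1:
  shows "\<exists>C::real. C > 0 \<and>
    (\<forall>(M :: 'a measure) (N :: nat) (p :: nat)
       (F :: nat \<Rightarrow> 'a measure) (\<eta> :: nat \<Rightarrow> 'a \<Rightarrow> nat \<Rightarrow> real).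
      prob_space M \<longrightarrow> N \<ge> 1 \<longrightarrow> p \<ge> 3 \<longrightarrow>
      finite_filtration M N F \<longrightarrow>
      (\<forall>i\<in>{1..N}. \<eta> i \<in> F i \<rightarrow>\<^sub>M borel_vec p) \<longrightarrow>
      (\<forall>i\<in>{1..N}. \<forall>j\<in>{1..p}. AE \<omega> in M. \<eta> i \<omega> j \<ge> 0) \<longrightarrow>
      (\<forall>i\<in>{1..N}. \<forall>j\<in>{1..p}. integrable M (\<lambda>\<omega>. \<eta> i \<omega> j)) \<longrightarrow>
      (\<forall>q::real. q \<ge> 1 \<longrightarrow>
        Lq_norm M q (\<lambda>\<omega>. MAX j\<in>{1..p}. \<Sum>i=1..N. \<eta> i \<omega> j)
        \<le> ennreal C *
          (Lq_norm M q (\<lambda>\<omega>. MAX j\<in>{1..p}. \<Sum>i=1..N. real_cond_exp M (F (i - 1)) (\<lambda>\<omega>'. \<eta> i \<omega>' j) \<omega>)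
           + ennreal (q + ln (real p)) *
             Lq_norm M q (\<lambda>\<omega>. MAX i\<in>{1..N}. MAX j\<in>{1..p}. \<eta> i \<omega> j))))"
proof (intro exI[of _ "48::real"] conjI allI impI)
  fix M :: "'a measure" and N p :: nat and F :: "nat \<Rightarrow> 'a measure"
    and \<eta> :: "nat \<Rightarrow> 'a \<Rightarrow> nat \<Rightarrow> real" and q :: real
  assume "prob_space M" and N: "1 \<le> N" and p: "3 \<le> p" and filt: "finite_filtration M N F"
    and adapted: "\<forall>i\<in>{1..N}. \<eta> i \<in> F i \<rightarrow>\<^sub>M borel_vec p"
    and nonneg: "\<forall>i\<in>{1..N}. \<forall>j\<in>{1..p}. AE \<omega> in M. \<eta> i \<omega> j \<ge> 0"
    and int: "\<forall>i\<in>{1..N}. \<forall>j\<in>{1..p}. integrable M (\<lambda>\<omega>. \<eta> i \<omega> j)"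
    and q: "1 \<le> q"
  interpret prob_space M by fact
  let ?a = "\<lambda>i j. real_cond_exp M (F (i - 1)) (\<lambda>\<omega>. \<eta> i \<omega> j)"
  define X where "X = (\<lambda>\<omega>. MAX j\<in>{1..p}. \<Sum>i=1..N. \<eta> i \<omega> j)"
  define A where "A = (\<lambda>\<omega>. MAX j\<in>{1..p}. \<Sum>i=1..N. ?a i j \<omega>)"
  define K where "K = (\<lambda>\<omega>. MAX i\<in>{1..N}. MAX j\<in>{1..p}. \<eta> i \<omega> j)"
  define L where "L = q + ln (real p)"
  have ln_p: "ln (real p) \<ge> 0" using p by simp
  then have L: "L \<ge> 1" using q by (simp add: L_def)
  have ne: "{1..N} \<noteq> {}" "{1..p} \<noteq> {}" using N p by auto
  have meas: "(\<lambda>\<omega>. \<eta> i \<omega> j) \<in> borel_measurable (F i)" if "i \<in> {1..N}" "j \<in> {1..p}" for i j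
    using measurable_compose[OF _ measurable_component_singleton[OF that(2)]] adapted that(1) by blast
  have \<eta>M [measurable]: "(\<lambda>\<omega>. \<eta> i \<omega> j) \<in> borel_measurable M" if "i \<in> {1..N}" "j \<in> {1..p}" for i j
    using int that by blast
  have XM [measurable]: "X \<in> borel_measurable M" unfolding X_def by measurable
  have AM [measurable]: "A \<in> borel_measurable M" unfolding A_def by measurable
  have KM [measurable]: "K \<in> borel_measurable M" unfolding K_def by measurable
  have X_gr: "X \<omega> > t \<longleftrightarrow> (\<exists>j\<in>{1..p}. (\<Sum>i=1..N. \<eta> i \<omega> j) > t)" for \<omega> t
    unfolding X_def using ne by (subst Max_gr_iff) auto
  have A_gr: "A \<omega> > t \<longleftrightarrow> (\<exists>j\<in>{1..p}. (\<Sum>i=1..N. ?a i j \<omega>) > t)" for \<omega> t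
    unfolding A_def using ne by (subst Max_gr_iff) auto
  have K_gr: "K \<omega> > t \<longleftrightarrow> (\<exists>i\<in>{1..N}. \<exists>j\<in>{1..p}. \<eta> i \<omega> j > t)" for \<omega> t
    unfolding K_def using ne by (subst Max_gr_iff) (auto simp: Max_gr_iff)
  have "AE \<omega> in M. \<forall>i\<in>{1..N}. \<forall>j\<in>{1..p}. 0 \<le> \<eta> i \<omega> j"
    using nonneg by (intro AE_finite_allI) auto
  then have X_bounds: "AE \<omega> in M. 0 \<le> X \<omega> \<and> \<bar>X \<omega>\<bar> \<le> \<bar>real N * K \<omega>\<bar>"
  proof eventually_elim
    case (elim \<omega>)
    have "X \<omega> \<in> (\<lambda>j. \<Sum>i=1..N. \<eta> i \<omega> j) ` {1..p}"
      unfolding X_def by (rule Max_in) (use ne in auto)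
    then obtain j where j: "j \<in> {1..p}" "X \<omega> = (\<Sum>i=1..N. \<eta> i \<omega> j)" by blast
    have "(\<Sum>i=1..N. \<eta> i \<omega> j) \<le> (\<Sum>i=1..N. K \<omega>)"
      using K_gr[of "K \<omega>" \<omega>] j(1) by (intro sum_mono) (auto simp: not_less)
    moreover have "0 \<le> X \<omega>" using j elim by (auto intro!: sum_nonneg)
    ultimately show ?case using j by simp
  qed
  have tail: "emeasure M {\<omega> \<in> space M. \<bar>1/3 * X \<omega>\<bar> > t}
      \<le> ennreal (exp (-4 * q)) * emeasure M {\<omega> \<in> space M. \<bar>X \<omega>\<bar> > t}
        + (emeasure M {\<omega> \<in> space M. \<bar>4 * A \<omega>\<bar> > t} + emeasure M {\<omega> \<in> space M. \<bar>8 * L * K \<omega>\<bar> > t})"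
    if t: "t > 0" for t
  proof -
    define b where "b = t / (8 * L)"
    have b: "0 < b" "b \<le> t" using t L by (auto simp: b_def divide_le_eq)
    have "t / (2 * b) = 4 * q + 4 * ln (real p)" using t L by (simp add: b_def L_def)
    then have "real p * exp (- (t / (2 * b))) = real p * (exp (-4 * q) * exp (- (4 * ln (real p))))"
      by (simp add: exp_add[symmetric])
    also have "\<dots> = exp (-4 * q) * (exp (ln (real p)) * exp (- (4 * ln (real p))))"
      using p by simp
    also have "\<dots> = exp (-4 * q) * exp (- (3 * ln (real p)))"
      by (simp add: exp_add[symmetric])
    also have "\<dots> \<le> exp (-4 * q)" using ln_p by simp
    finally have coeff: "real p * exp (- (t / (2 * b))) \<le> exp (-4 * q)" .
    have "measure M {\<omega> \<in> space M. \<bar>1/3 * X \<omega>\<bar> > t} = measure M {\<omega> \<in> space M. X \<omega> > 3 * t}"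
      by (rule measure_eq_AE) (use X_bounds in \<open>auto elim!: eventually_mono\<close>)
    also have "\<dots> \<le> real p * exp (- (t / (2 * b))) * measure M {\<omega> \<in> space M. X \<omega> > t}
        + (measure M {\<omega> \<in> space M. A \<omega> > t / 4} + measure M {\<omega> \<in> space M. K \<omega> > b})"
      unfolding X_gr A_gr K_gr
      using good_lambda_max[of M N F "{1..p}" \<eta> b t] b nonneg int meas
        finite_filtration_subalgebra[OF filt] finite_filtration_mono[OF filt] \<open>prob_space M\<close>
      by simp
    also have "\<dots> \<le> exp (-4 * q) * measure M {\<omega> \<in> space M. \<bar>X \<omega>\<bar> > t}
        + (measure M {\<omega> \<in> space M. \<bar>4 * A \<omega>\<bar> > t} + measure M {\<omega> \<in> space M. \<bar>8 * L * K \<omega>\<bar> > t})"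
    proof (intro add_mono mult_mono coeff finite_measure_mono)
      show "{\<omega> \<in> space M. K \<omega> > b} \<subseteq> {\<omega> \<in> space M. \<bar>8 * L * K \<omega>\<bar> > t}"
        using L by (auto simp: b_def divide_less_eq mult_ac intro: less_le_trans[OF _ abs_ge_self])
    qed auto
    finally show ?thesis
      by (simp add: emeasure_eq_measure ennreal_mult[symmetric] ennreal_plus[symmetric]
          del: ennreal_plus)
  qed
  let ?I = "\<lambda>f. \<integral>\<^sup>+\<omega>. ennreal (\<bar>f \<omega>\<bar> powr q) \<partial>M"
  have "?I (\<lambda>\<omega>. 1/3 * X \<omega>) \<le> ennreal (exp (-4 * q)) * ?I X + (?I (\<lambda>\<omega>. 4 * A \<omega>) + ?I (\<lambda>\<omega>. 8 * L * K \<omega>))"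
    by (rule nn_integral_powr_le_of_tail_le) (use q tail sigma_finite_measure_axioms in auto)
  also have "?I (\<lambda>\<omega>. 4 * A \<omega>) = ennreal (4 powr q) * ?I A"
    by (rule nn_integral_abs_powr_cmult) auto
  also have "?I (\<lambda>\<omega>. 8 * L * K \<omega>) = ennreal ((8 * L) powr q) * ?I K"
    by (rule nn_integral_abs_powr_cmult) (use L in auto)
  also have "?I (\<lambda>\<omega>. 1/3 * X \<omega>) = ennreal ((1/3) powr q) * ?I X"
    by (rule nn_integral_abs_powr_cmult) auto
  finally have main: "ennreal ((1/3) powr q) * ?I X
    \<le> ennreal (exp (-4 * q)) * ?I X + (ennreal (4 powr q) * ?I A + ennreal ((8 * L) powr q) * ?I K)" .
  \<comment> \<open>A finite moment of \<open>K\<close> makes that of \<open>X\<close> finite; the factor depending on \<open>N\<close> does not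
    enter the constant.\<close>
  have IX: "?I X \<le> ennreal (real N powr q) * ?I K"
  proof -
    have "?I X \<le> ?I (\<lambda>\<omega>. real N * K \<omega>)"
    proof (rule nn_integral_mono_AE)
      show "AE \<omega> in M. ennreal (\<bar>X \<omega>\<bar> powr q) \<le> ennreal (\<bar>real N * K \<omega>\<bar> powr q)"
        using X_bounds by eventually_elim (use q in \<open>auto intro!: ennreal_leI powr_mono2\<close>)
    qed
    then show ?thesis using nn_integral_abs_powr_cmult[of K M "real N" q] by simp
  qed
  have "Lq_norm M q X \<le> ennreal 48 * (Lq_norm M q A + ennreal L * Lq_norm M q K)"
  proof (cases rule: Lq_norm_cases[where f = A and q = q and M = M])
    case 1
    then show ?thesis by (simp add: ennreal_mult_top)
  next
    case A: (2 a)
    show ?thesis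
    proof (cases rule: Lq_norm_cases[where f = K and q = q and M = M])
      case 1
      then show ?thesis using L by (simp add: ennreal_mult_top)
    next
      case K: (2 m)
      show ?thesis
      proof (cases rule: Lq_norm_cases[where f = X and q = q and M = M])
        case 1
        then show ?thesis using IX K by (simp add: ennreal_mult[symmetric] top_unique)
      next
        case X: (2 x)
        have "(1/3) powr q * x \<le> exp (-4 * q) * x + (4 powr q * a + (8 * L) powr q * m)"
          using main A(1) K(1) X(1) unfolding A(2) K(2) X(2)
          by (simp add: ennreal_mult[symmetric] ennreal_plus[symmetric] del: ennreal_plus)
        from absorb_good_lambda[OF q _ X(1) A(1) K(1) this]
        have "x powr (1 / q) \<le> 48 * (a powr (1 / q) + L * m powr (1 / q))" using L by simp
        then have "ennreal (x powr (1 / q)) \<le> ennreal (48 * (a powr (1 / q) + L * m powr (1 / q)))"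
          by (rule ennreal_leI)
        also have "\<dots> = ennreal 48 * (ennreal (a powr (1 / q)) + ennreal L * ennreal (m powr (1 / q)))"
          using L by (subst ennreal_mult) (auto simp: ennreal_mult)
        finally show ?thesis unfolding A(3) K(3) X(3) .
      qed
    qed
  qed
  then show "Lq_norm M q (\<lambda>\<omega>. MAX j\<in>{1..p}. \<Sum>i=1..N. \<eta> i \<omega> j)
        \<le> ennreal 48 *
          (Lq_norm M q (\<lambda>\<omega>. MAX j\<in>{1..p}. \<Sum>i=1..N. real_cond_exp M (F (i - 1)) (\<lambda>\<omega>'. \<eta> i \<omega>' j) \<omega>)
           + ennreal (q + ln (real p)) *
             Lq_norm M q (\<lambda>\<omega>. MAX i\<in>{1..N}. MAX j\<in>{1..p}. \<eta> i \<omega> j))"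
    unfolding X_def A_def K_def L_def .
qed simp

end
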